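(* Let $\mathcal A$ be a unital Banach algebra with commuting derivations $\delta_1,\dots,\delta_d$, and let $M=(M_k)_{k\ge 0}$ be a sequence of positive numbers with $M_0=1$ and log-convex regularization $M^c$. If $C_M(\mathcal A)=C_{M^c}(\mathcal A)$ and if the sequence $(M_k/k!)^{1/k}$ is almost increasing, then the Carleman class $C_M(\mathcal A)$ is inverse-closed in $\mathcal A$, i.e. every $a\in C_M(\mathcal A)$ that is invertible in $\mathcal A$ satisfies $a^{-1}\in C_M(\mathcal A)$.
   Context: A derivation $\delta$ on $\mathcal A$ is a closed linear map $\delta:\mathcal D(\delta)\to\mathcal A$, where the domain $\mathcal D(\delta)$ is a subspace of $\mathcal A$, satisfying the Leibniz rule $\delta(ab)=a\delta(b)+\delta(a)b$ for all $a,b\in\mathcal D(\delta)$. (If $\mathcal A$ is a $*$-algebra, derivations are assumed symmetric: $\mathcal D(\delta)^*=\mathcal D(\delta)$ and $\delta(a^* )=\delta(a)^*$.) Domains of compositions $\delta_{r_1}\cdots\delta_{r_n}$ are defined inductively, and for a multi-index $\alpha\in\mathbb N_0^d$ one sets $\delta^\alpha=\delta_1^{\alpha_1}\cdots\delta_d^{\alpha_d}$, $|\alpha|=\sum_j\alpha_j$. For $r>0$, $C_{r,M}(\mathcal A)$ is the space of $a\in\mathcal A$ (with all $\delta^\alpha(a)$ defined) for which the norm $\sup_{\alpha\in\mathbb N_0^d}\frac{\|\delta^\alpha(a)\|_{\mathcal A}}{r^{|\alpha|}M_{|\alpha|}}$ is finite, and the Carleman class is $C_M(\mathcal A)=\bigcup_{r>0}C_{r,M}(\mathcal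 A)$. The log-convex regularization $M^c$ of $M$ is the largest logarithmically convex sequence smaller than or equal to $M$. A sequence of positive numbers $(u_k)$ is almost increasing if there is a constant $C>0$ with $u_k\le Cu_l$ for all $k<l$.
   Formalization: The domain of each derivation is additionally assumed inverse-closed in the algebra; without this the claim fails, e.g. for the zero derivation on the disc algebra inside C(T) with M_k = k!, where z lies in the class but 1/z does not. *)

theory Defs
  imports "HOL-Analysis.Analysis"
begin

text \<open>
  Unital Banach algebras are types of sort
  \<open>{real_normed_algebra, ring_1, banach}\<close>: the norm of the unit is not normalised, and a complex
  Banach algebra with complex-linear derivations is in particular an instance.  Unbounded
  operators are partial maps, so that \<open>\<circ>\<^sub>m\<close> carries the natural domain of a composition.
\<close>

definition derivation :: "('a::{real_normed_algebra, ring_1, banach} \<rightharpoonup> 'a) \<Rightarrow> bool" where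
  \<comment> \<open>The graph is a subspace iff the domain is a subspace and the map is linear on it.\<close>
  "derivation \<delta> \<longleftrightarrow>
     subspace (Map.graph \<delta>) \<and> closed (Map.graph \<delta>) \<and>
     (\<forall>a b a' b'. \<delta> a = Some a' \<and> \<delta> b = Some b' \<longrightarrow> \<delta> (a * b) = Some (a * b' + a' * b))"

text \<open>
  Only agreement on the common domain of the two compositions is required; equality of these
  domains is not.
\<close>
definition commute :: "('a \<rightharpoonup> 'a) \<Rightarrow> ('a \<rightharpoonup> 'a) \<Rightarrow> bool" where
  "commute \<delta> \<epsilon> \<longleftrightarrow> (\<forall>a b c. (\<delta> \<circ>\<^sub>m \<epsilon>) a = Some b \<and> (\<epsilon> \<circ>\<^sub>m \<delta>) a = Some c \<longrightarrow> b = c)"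

text \<open>
  A multi-index is a function on \<open>nat\<close> of which only the values at \<open>1, \<dots>, d\<close> are used.
  The partial map below is \<open>\<delta>\<^sub>1\<close> iterated \<open>\<alpha> 1\<close> times, after \<open>\<delta>\<^sub>2\<close> iterated \<open>\<alpha> 2\<close> times, and so on,
  with \<open>\<delta>\<^sub>d\<close> applied first.
\<close>
definition multi_deriv :: "nat \<Rightarrow> (nat \<Rightarrow> 'a \<rightharpoonup> 'a) \<Rightarrow> (nat \<Rightarrow> nat) \<Rightarrow> ('a \<rightharpoonup> 'a)" where
  "multi_deriv d \<delta> \<alpha> = foldr (\<lambda>j. (\<lambda>f. \<delta> j \<circ>\<^sub>m f) ^^ \<alpha> j) [1..<Suc d] Some"

definition multi_order :: "nat \<Rightarrow> (nat \<Rightarrow> nat) \<Rightarrow> nat" where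
  "multi_order d \<alpha> = (\<Sum>j=1..d. \<alpha> j)"

definition carleman_at ::
  "nat \<Rightarrow> (nat \<Rightarrow> 'a::{real_normed_algebra, ring_1, banach} \<rightharpoonup> 'a) \<Rightarrow> real \<Rightarrow> (nat \<Rightarrow> real) \<Rightarrow> 'a set"
  where
  "carleman_at d \<delta> r M =
     {a. (\<forall>\<alpha>. a \<in> dom (multi_deriv d \<delta> \<alpha>)) \<and>
         bdd_above (range (\<lambda>\<alpha>. norm (the (multi_deriv d \<delta> \<alpha> a)) /
                                (r ^ multi_order d \<alpha> * M (multi_order d \<alpha>))))}"

definition carleman_class ::
  "nat \<Rightarrow> (nat \<Rightarrow> 'a::{real_normed_algebra, ring_1, banach} \<rightharpoonup> 'a) \<Rightarrow> (nat \<Rightarrow> real) \<Rightarrow> 'a set"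
  where
  "carleman_class d \<delta> M = (\<Union>r\<in>{0<..}. carleman_at d \<delta> r M)"

definition log_convex :: "(nat \<Rightarrow> real) \<Rightarrow> bool" where
  "log_convex N \<longleftrightarrow> (\<forall>k. 0 < N k) \<and> (\<forall>k. (N (Suc k))\<^sup>2 \<le> N k * N (Suc (Suc k)))"

definition log_convex_regularization :: "(nat \<Rightarrow> real) \<Rightarrow> (nat \<Rightarrow> real) \<Rightarrow> bool" where
  "log_convex_regularization M Mc \<longleftrightarrow>
     log_convex Mc \<and> Mc \<le> M \<and> (\<forall>N. log_convex N \<and> N \<le> M \<longrightarrow> N \<le> Mc)"

definition almost_increasing :: "(nat \<Rightarrow> real) \<Rightarrow> bool" where
  "almost_increasing u \<longleftrightarrow> (\<exists>C>0. \<forall>k l. k < l \<longrightarrow> u k \<le> C * u l)"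

text \<open>
  The domain of a closed derivation need not be inverse-closed: in the algebra of continuous
  functions on the unit circle, the zero map defined on the disc algebra is a closed derivation,
  the coordinate function lies in its domain, and its inverse does not.  Since all Carleman
  classes of that derivation are equal to the disc algebra, inverse-closedness of the domains has
  to be a hypothesis of any result on inverse-closed Carleman classes in general Banach algebras.
  It holds, for instance, for densely defined derivations and for symmetric derivations of
  C*-algebras.
\<close>
definition inverse_closed :: "'a::ring_1 set \<Rightarrow> bool" where
  "inverse_closed S \<longleftrightarrow> (\<forall>a\<in>S. \<forall>b. a * b = 1 \<and> b * a = 1 \<longrightarrow> b \<in> S)"

end

theory Submission
  imports Defs "HOL-Library.Multiset" "HOL-Library.Sublist"
begin

text \<open>
  Write \<open>b\<close> for the inverse of \<open>a\<close>.  An ordered monomial in the derivations is a sorted word, and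
  applying it to \<open>a * b = 1\<close> with the Leibniz rule expresses the corresponding derivative of \<open>b\<close>
  by derivatives of \<open>a\<close> and lower derivatives of \<open>b\<close>.  Subwords of sorted words are sorted, so
  only ordered monomials ever occur.  To estimate the derivatives of order \<open>K\<close>, almost
  monotonicity gives \<open>M k \<le> k! * s ^ k\<close> for all \<open>k \<le> K\<close>, where \<open>s\<close> is a constant multiple of
  \<open>(M K / K!) powr (1 / K)\<close>.  With these analytic bounds on \<open>a\<close> up to order \<open>K\<close>, the recursion
  yields analytic bounds on \<open>b\<close> up to order \<open>K\<close> by a geometric series, and the bound at order \<open>K\<close>
  itself is a multiple of \<open>M K\<close> up to a factor \<open>R ^ K\<close>.
\<close>

section \<open>Sums over the splittings of a word\<close>

text \<open>
  The sum of \<open>G u v\<close> over all ways of splitting a word into a subword \<open>u\<close> and the complementary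
  subword \<open>v\<close>, counted with multiplicity.
\<close>
primrec split_sum :: "('i list \<Rightarrow> 'i list \<Rightarrow> 'b::comm_monoid_add) \<Rightarrow> 'i list \<Rightarrow> 'b" where
  "split_sum G [] = G [] []"
| "split_sum G (j # w) = split_sum (\<lambda>u v. G (j # u) v) w + split_sum (\<lambda>u v. G u (j # v)) w"

lemma split_sum_add:
  "split_sum (\<lambda>u v. G u v + H u v) w = split_sum G w + split_sum H w"
  by (induction w arbitrary: G H) (simp_all add: ac_simps)

text \<open>The empty \<open>u\<close> arises from exactly one splitting, the one that puts every
  letter into \<open>v\<close>. In the expansion of a derivative of a product this isolates the term
  whose first factor is undifferentiated.\<close>

lemma split_sum_remove:
  "split_sum G w = G [] w + split_sum (\<lambda>u v. if u = [] then 0 else G u v) w"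
proof (induction w arbitrary: G)
  case (Cons j w)
  from Cons.IH[of "\<lambda>u v. G u (j # v)"] show ?case
    by (simp add: ac_simps)
qed simp

lemma norm_split_sum_le:
  fixes G :: "'i list \<Rightarrow> 'i list \<Rightarrow> 'b::real_normed_vector"
  shows "norm (split_sum G w) \<le> split_sum (\<lambda>u v. norm (G u v)) w"
proof (induction w arbitrary: G)
  case (Cons j w)
  show ?case
    using norm_triangle_mono[OF Cons.IH Cons.IH] by simp
qed simp

lemma split_sum_mono:
  fixes G H :: "'i list \<Rightarrow> 'i list \<Rightarrow> 'b::ordered_comm_monoid_add"
  assumes "\<And>u v. subseq u w \<Longrightarrow> subseq v w \<Longrightarrow> length u + length v = length w \<Longrightarrow> G u v \<le> H u v"
  shows "split_sum G w \<le> split_sum H w"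
  using assms
proof (induction w arbitrary: G H)
  case (Cons j w)
  show ?case
    unfolding split_sum.simps by (intro add_mono Cons.IH Cons.prems) auto
qed simp

text \<open>Pascal's rule, in the shape of the recursion for \<open>split_sum\<close>: a new letter
  joins either the first subword or the second.\<close>

lemma sum_binomial_Suc:
  fixes F :: "nat \<Rightarrow> nat \<Rightarrow> real"
  shows "(\<Sum>k\<le>Suc n. (Suc n choose k) * F k (Suc n - k)) =
    (\<Sum>k\<le>n. (n choose k) * F (Suc k) (n - k)) + (\<Sum>k\<le>n. (n choose k) * F k (Suc (n - k)))"
proof -
  have "(\<Sum>k\<le>n. (n choose k) * F k (Suc (n - k))) = (\<Sum>k\<le>Suc n. (n choose k) * F k (Suc n - k))"
    by (simp add: Suc_diff_le)
  then show ?thesis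
    by (simp only: sum.atMost_Suc_shift) (simp add: sum.distrib algebra_simps)
qed

text \<open>Counting splittings by the length of \<open>u\<close> gives binomial coefficients, so
  estimates that depend on orders alone become binomial convolutions.\<close>

lemma split_sum_length:
  fixes F :: "nat \<Rightarrow> nat \<Rightarrow> real"
  shows "split_sum (\<lambda>u v. F (length u) (length v)) w =
    (\<Sum>k\<le>length w. (length w choose k) * F k (length w - k))"
proof (induction w arbitrary: F)
  case (Cons j w)
  from Cons.IH[of "\<lambda>k l. F (Suc k) l"] Cons.IH[of "\<lambda>k l. F k (Suc l)"] show ?case
    using sum_binomial_Suc[of "length w" F] by simp
qed simp

section \<open>Derivations along words\<close>

text \<open>The head of the word acts last, as \<open>\<delta> 1\<close> does in
  \<open>multi_deriv\<close>.\<close>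

definition word_deriv :: "('i \<Rightarrow> 'a \<rightharpoonup> 'a) \<Rightarrow> 'i list \<Rightarrow> 'a \<rightharpoonup> 'a" where
  "word_deriv \<delta> w = foldr (\<lambda>j f. \<delta> j \<circ>\<^sub>m f) w Some"

lemma word_deriv_Nil [simp]: "word_deriv \<delta> [] = Some"
  by (simp add: word_deriv_def)

lemma word_deriv_Cons: "word_deriv \<delta> (j # w) = \<delta> j \<circ>\<^sub>m word_deriv \<delta> w"
  by (simp add: word_deriv_def)

lemma word_deriv_ConsD:
  assumes "a \<in> dom (word_deriv \<delta> (j # w))"
  shows "\<delta> j (the (word_deriv \<delta> w a)) = Some (the (word_deriv \<delta> (j # w) a))"
  using assms by (auto simp: word_deriv_Cons map_comp_def split: option.splits)

lemma derivation_add: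
  assumes "derivation \<delta>" "\<delta> a = Some a'" "\<delta> b = Some b'"
  shows "\<delta> (a + b) = Some (a' + b')"
proof -
  have "(a, a') + (b, b') \<in> Map.graph \<delta>"
    using assms unfolding derivation_def by (intro subspace_add) (auto simp: Map.graph_def)
  then show ?thesis
    by (simp add: Map.graph_def)
qed

lemma derivation_minus:
  assumes "derivation \<delta>" "\<delta> a = Some a'"
  shows "\<delta> (- a) = Some (- a')"
proof -
  have "- (a, a') \<in> Map.graph \<delta>"
    using assms unfolding derivation_def by (intro subspace_neg) (auto simp: Map.graph_def)
  then show ?thesis
    by (simp add: Map.graph_def)
qed

lemma derivation_zero:
  assumes "derivation \<delta>"
  shows "\<delta> 0 = Some 0"
proof -
  have "(0 :: 'a \<times> 'a) \<in> Map.graph \<delta>"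
    using assms unfolding derivation_def by (intro subspace_0) auto
  then show ?thesis
    by (simp add: Map.graph_def zero_prod_def)
qed

lemma derivation_mult:
  assumes "derivation \<delta>" "\<delta> a = Some a'" "\<delta> b = Some b'"
  shows "\<delta> (a * b) = Some (a * b' + a' * b)"
  using assms unfolding derivation_def by blast

text \<open>The Leibniz rule on \<open>1 * 1\<close> gives \<open>e = e + e\<close>.\<close>

lemma derivation_one:
  assumes "derivation \<delta>" "1 \<in> dom \<delta>"
  shows "\<delta> 1 = Some 0"
proof -
  from assms obtain e where e: "\<delta> 1 = Some e"
    by blast
  from derivation_mult[OF assms(1) e e] e show ?thesis
    by simp
qed

lemma derivation_split_sum:
  assumes "derivation \<delta>"
    and "\<And>u v. subseq u w \<Longrightarrow> subseq v w \<Longrightarrow> length u + length v = length w \<Longrightarrow>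
           \<delta> (G u v) = Some (H u v)"
  shows "\<delta> (split_sum G w) = Some (split_sum H w)"
  using assms(2)
proof (induction w arbitrary: G H)
  case (Cons j w)
  show ?case
    unfolding split_sum.simps
    by (intro derivation_add[OF assms(1)] Cons.IH Cons.prems) auto
qed simp

text \<open>The head letter falls on one of the two factors, which is the recursion of
  \<open>split_sum\<close>. Only subwords of \<open>w\<close> appear, so domain conditions on these
  suffice.\<close>

lemma word_deriv_mult:
  assumes "\<And>j. j \<in> set w \<Longrightarrow> derivation (\<delta> j)"
    and "\<And>u. subseq u w \<Longrightarrow> x \<in> dom (word_deriv \<delta> u)"
    and "\<And>u. subseq u w \<Longrightarrow> y \<in> dom (word_deriv \<delta> u)"
  shows "word_deriv \<delta> w (x * y) =
    Some (split_sum (\<lambda>u v. the (word_deriv \<delta> u x) * the (word_deriv \<delta> v y)) w)"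
  using assms
proof (induction w)
  case (Cons j w)
  let ?D = "\<lambda>u z. the (word_deriv \<delta> u z)"
  have IH: "word_deriv \<delta> w (x * y) = Some (split_sum (\<lambda>u v. ?D u x * ?D v y) w)"
    by (intro Cons.IH Cons.prems) auto
  have der: "derivation (\<delta> j)"
    by (rule Cons.prems) simp
  have "\<delta> j (split_sum (\<lambda>u v. ?D u x * ?D v y) w) =
    Some (split_sum (\<lambda>u v. ?D u x * ?D (j # v) y + ?D (j # u) x * ?D v y) w)"
    by (intro derivation_split_sum derivation_mult der word_deriv_ConsD Cons.prems(2,3)) auto
  with IH show ?case
    by (simp add: word_deriv_Cons split_sum_add add.commute)
qed simp

lemma word_deriv_one:
  assumes "\<And>j. j \<in> set w \<Longrightarrow> derivation (\<delta> j)" "\<And>j. j \<in> set w \<Longrightarrow> 1 \<in> dom (\<delta> j)" "w \<noteq> []"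
  shows "word_deriv \<delta> w 1 = Some 0"
  using assms
proof (induction w)
  case (Cons j w)
  then show ?case
    by (cases "w = []") (simp_all add: word_deriv_Cons derivation_one derivation_zero)
qed simp

text \<open>Expand the vanishing derivative of \<open>a * b = 1\<close>, solve for the term in which
  all letters fall on \<open>b\<close>, and cancel \<open>a\<close> by multiplying with
  \<open>b\<close> from the left.\<close>

lemma word_deriv_inverse:
  assumes "\<And>j. j \<in> set w \<Longrightarrow> derivation (\<delta> j)"
    and "\<And>u. subseq u w \<Longrightarrow> a \<in> dom (word_deriv \<delta> u)"
    and "\<And>u. subseq u w \<Longrightarrow> b \<in> dom (word_deriv \<delta> u)"
    and "a * b = 1" "b * a = 1" "w \<noteq> []"
  shows "the (word_deriv \<delta> w b) = - (b * split_sum (\<lambda>u v. if u = [] then 0 else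
           the (word_deriv \<delta> u a) * the (word_deriv \<delta> v b)) w)" (is "?x = - (b * ?S)")
proof -
  \<comment> \<open>The unit is the product of \<open>a\<close> and \<open>b\<close>, and one-letter
    subwords put both into the domain.\<close>
  have "1 \<in> dom (\<delta> j)" if "j \<in> set w" for j
  proof -
    have "subseq [j] w"
      using that by (simp add: subseq_singleton_left)
    from assms(2,3)[OF this] obtain a' b' where "\<delta> j a = Some a'" "\<delta> j b = Some b'"
      by (auto simp: word_deriv_Cons)
    from derivation_mult[OF assms(1)[OF that] this] show ?thesis
      using assms(4) by auto
  qed
  then have "word_deriv \<delta> w (a * b) = Some 0"
    using assms(1,4,6) by (simp add: word_deriv_one)
  moreover have "word_deriv \<delta> w (a * b) = Some (a * ?x + ?S)"
    using word_deriv_mult[OF assms(1-3)] by (subst (asm) split_sum_remove) simp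
  ultimately have "a * ?x = - ?S"
    by (simp add: eq_neg_iff_add_eq_0)
  then have "b * a * ?x = - (b * ?S)"
    by (simp add: mult.assoc)
  then show ?thesis
    using assms(5) by simp
qed

section \<open>Ordered monomials as sorted words\<close>

definition multi_word :: "nat \<Rightarrow> (nat \<Rightarrow> nat) \<Rightarrow> nat list" where
  "multi_word d \<alpha> = concat (map (\<lambda>j. replicate (\<alpha> j) j) [1..<Suc d])"

lemma foldr_funpow:
  "foldr (\<lambda>j. f j ^^ \<alpha> j) js = foldr f (concat (map (\<lambda>j. replicate (\<alpha> j) j) js))"
  by (induction js) (simp_all add: foldr_replicate)

lemma multi_deriv_eq_word_deriv: "multi_deriv d \<delta> \<alpha> = word_deriv \<delta> (multi_word d \<alpha>)"
  unfolding multi_deriv_def word_deriv_def multi_word_def foldr_funpow ..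

lemma length_multi_word: "length (multi_word d \<alpha>) = multi_order d \<alpha>"
  by (simp add: multi_word_def multi_order_def length_concat comp_def
      interv_sum_list_conv_sum_set_nat atLeastLessThanSuc_atLeastAtMost del: upt_Suc)

lemma set_multi_word: "set (multi_word d \<alpha>) \<subseteq> {1..d}"
  by (auto simp: multi_word_def)

lemma sorted_concat_replicate:
  assumes "sorted js"
  shows "sorted (concat (map (\<lambda>j. replicate (\<alpha> j) j) js))"
  using assms by (induction js) (auto simp: sorted_append)

lemma sorted_multi_word: "sorted (multi_word d \<alpha>)"
  unfolding multi_word_def by (intro sorted_concat_replicate sorted_upt)

lemma count_concat_replicate:
  assumes "distinct js"
  shows "count (mset (concat (map (\<lambda>j. replicate (\<alpha> j) j) js))) x = (if x \<in> set js then \<alpha> x else 0)"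
  using assms by (induction js) auto

text \<open>A sorted word is determined by its multiset of letters. Hence quantifying over
  multi-indices and over sorted words is the same.\<close>

lemma multi_word_count:
  assumes "sorted w" "set w \<subseteq> {1..d}"
  shows "multi_word d (count (mset w)) = w"
proof -
  have "mset (multi_word d (count (mset w))) = mset w"
    unfolding multi_word_def
    by (rule multiset_eqI, subst count_concat_replicate)
       (use assms(2) in \<open>auto simp: count_eq_zero_iff simp del: upt_Suc\<close>)
  then show ?thesis
    using assms(1) sorted_multi_word by (metis properties_for_sort sorted_sort_id)
qed

lemma all_multi_word_iff:
  "(\<forall>\<alpha>. P (multi_word d \<alpha>)) \<longleftrightarrow> (\<forall>w. sorted w \<and> set w \<subseteq> {1..d} \<longrightarrow> P w)"
  by (metis multi_word_count set_multi_word sorted_multi_word)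

lemma mem_carleman_at_iff:
  assumes "0 < r" "\<And>k. 0 < M k"
  shows "a \<in> carleman_at d \<delta> r M \<longleftrightarrow>
    (\<forall>w. sorted w \<and> set w \<subseteq> {1..d} \<longrightarrow> a \<in> dom (word_deriv \<delta> w)) \<and>
    (\<exists>A. \<forall>w. sorted w \<and> set w \<subseteq> {1..d} \<longrightarrow>
       norm (the (word_deriv \<delta> w a)) \<le> A * (r ^ length w * M (length w)))"
proof -
  have "0 < r ^ n * M n" for n
    using assms by simp
  then show ?thesis
    unfolding carleman_at_def multi_deriv_eq_word_deriv all_multi_word_iff[symmetric]
    by (auto simp: bdd_above_def length_multi_word pos_divide_le_eq)
qed

section \<open>The inverse of an element with all derivatives\<close>

lemma subseq_sorted_subset:
  assumes "subseq u w" "sorted w" "set w \<subseteq> I"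
  shows "sorted u" "set u \<subseteq> I" "length u \<le> length w"
proof -
  from assms(1) obtain N where "u = nths w N"
    by (auto simp: subseq_conv_nths)
  then show "sorted u" "set u \<subseteq> I"
    using assms(2,3) set_nths_subset[of w N] by (auto simp: sorted_nths)
qed (rule list_emb_length[OF assms(1)])

text \<open>Induction on length: for \<open>w = j # v\<close>, the formula of
  \<open>word_deriv_inverse\<close> for the derivative along \<open>v\<close> involves only elements
  to which \<open>\<delta> j\<close> applies.\<close>

lemma word_deriv_inverse_dom:
  assumes der: "\<And>j. j \<in> I \<Longrightarrow> derivation (\<delta> j)"
    and inv: "\<And>j. j \<in> I \<Longrightarrow> inverse_closed (dom (\<delta> j))"
    and a: "\<And>w. sorted w \<Longrightarrow> set w \<subseteq> I \<Longrightarrow> a \<in> dom (word_deriv \<delta> w)"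
    and ab: "a * b = 1" "b * a = 1"
  shows "sorted w \<Longrightarrow> set w \<subseteq> I \<Longrightarrow> b \<in> dom (word_deriv \<delta> w)"
proof (induction w rule: length_induct)
  case (1 w)
  show ?case
  proof (cases w)
    case (Cons j v)
    have j: "sorted (j # v)" "set (j # v) \<subseteq> I" "j \<in> I" "sorted v" "set v \<subseteq> I"
      using 1 Cons by simp_all
    have sub: "sorted (j # u)" "set (j # u) \<subseteq> I" "sorted u" "set u \<subseteq> I" "length u \<le> length v"
      if "subseq u v" for u
      using subseq_sorted_subset[of "j # u" "j # v" I] subseq_sorted_subset[of u v I] that j by auto
    have IH: "b \<in> dom (word_deriv \<delta> u)" if "subseq u v" for u
      using 1(1) sub(3-5)[OF that] Cons by simp
    have aj: "a \<in> dom (word_deriv \<delta> (j # u))" if "subseq u v" for u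
      by (rule a[OF sub(1,2)[OF that]])
    have "a \<in> dom (\<delta> j)"
      using aj[of "[]"] by (simp add: word_deriv_Cons dom_def)
    \<comment> \<open>Inverse-closedness of the domain supplies the first derivative, also needed
      below for the factor \<open>b\<close> in front of the sum.\<close>
    then obtain b' where b': "\<delta> j b = Some b'"
      using inv[OF j(3)] ab unfolding inverse_closed_def by blast
    show ?thesis
    proof (cases "v = []")
      case True
      then show ?thesis
        using b' Cons by (simp add: word_deriv_Cons dom_def)
    next
      case False
      let ?G = "\<lambda>u v'. if u = [] then 0 else the (word_deriv \<delta> u a) * the (word_deriv \<delta> v' b)"
      have G: "\<delta> j (?G u v') = Some (the (\<delta> j (?G u v')))"
        if "subseq u v" "subseq v' v" "length u + length v' = length v" for u v'
      proof (cases "u = []")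
        case True
        then show ?thesis
          using derivation_zero[OF der[OF j(3)]] by simp
      next
        case False
        \<comment> \<open>A nonempty \<open>u\<close> takes a letter away from \<open>v'\<close>,
          which leaves room for \<open>j\<close>.\<close>
        then have "length (j # v') < length w"
          using that(3) Cons by (cases u) auto
        then have "b \<in> dom (word_deriv \<delta> (j # v'))"
          using 1(1) sub(1,2)[OF that(2)] by blast
        from derivation_mult[OF der[OF j(3)] word_deriv_ConsD[OF aj[OF that(1)]]
            word_deriv_ConsD[OF this]]
        show ?thesis
          using False by simp
      qed
      have "\<delta> j (split_sum ?G v) = Some (split_sum (\<lambda>u v'. the (\<delta> j (?G u v'))) v)"
        by (intro derivation_split_sum der j(3) G)
      from derivation_minus[OF der[OF j(3)] derivation_mult[OF der[OF j(3)] b' this]]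
      obtain y where "\<delta> j (- (b * split_sum ?G v)) = Some y"
        by blast
      moreover have "the (word_deriv \<delta> v b) = - (b * split_sum ?G v)"
        using j(5) by (intro word_deriv_inverse der a sub IH ab False) auto
      ultimately have "the (word_deriv \<delta> v b) \<in> dom (\<delta> j)"
        by (simp add: domI)
      then show ?thesis
        using IH[of v] Cons by (auto simp: word_deriv_Cons)
    qed
  qed simp
qed

section \<open>Factorial bounds on the derivatives of the inverse\<close>

lemma geometric_sum_ratio:
  fixes r c :: real
  shows "c * (\<Sum>k=1..n. r ^ k * (r * (1 + c)) ^ (n - k)) = (r * (1 + c)) ^ n - r ^ n"
proof (induction n)
  case (Suc n)
  let ?\<rho> = "r * (1 + c)"
  have "(\<Sum>k=1..Suc n. r ^ k * ?\<rho> ^ (Suc n - k)) = ?\<rho> * (\<Sum>k=1..n. r ^ k * ?\<rho> ^ (n - k)) + r ^ Suc n"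
    by (simp add: sum_distrib_left Suc_diff_le mult.left_commute)
  then have "c * (\<Sum>k=1..Suc n. r ^ k * ?\<rho> ^ (Suc n - k)) =
      ?\<rho> * (c * (\<Sum>k=1..n. r ^ k * ?\<rho> ^ (n - k))) + c * r ^ Suc n"
    by (simp add: algebra_simps)
  also have "\<dots> = ?\<rho> ^ Suc n - r ^ Suc n"
    unfolding Suc.IH by (simp add: algebra_simps)
  finally show ?case .
qed simp

lemma word_deriv_inverse_bound:
  assumes der: "\<And>j. j \<in> I \<Longrightarrow> derivation (\<delta> j)"
    and a: "\<And>w. sorted w \<Longrightarrow> set w \<subseteq> I \<Longrightarrow> a \<in> dom (word_deriv \<delta> w)"
    and b: "\<And>w. sorted w \<Longrightarrow> set w \<subseteq> I \<Longrightarrow> b \<in> dom (word_deriv \<delta> w)"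
    and ab: "a * b = 1" "b * a = 1"
    and bound: "\<And>w. sorted w \<Longrightarrow> set w \<subseteq> I \<Longrightarrow> length w \<le> K \<Longrightarrow> w \<noteq> [] \<Longrightarrow>
      norm (the (word_deriv \<delta> w a)) \<le> A * r ^ length w * fact (length w)"
    and nonneg: "0 \<le> A" "0 \<le> r"
  shows "sorted w \<Longrightarrow> set w \<subseteq> I \<Longrightarrow> length w \<le> K \<Longrightarrow>
    norm (the (word_deriv \<delta> w b)) \<le>
      norm b * (r * (1 + norm b * A)) ^ length w * fact (length w)"
proof (induction w rule: length_induct)
  case (1 w)
  show ?case
  proof (cases "w = []")
    case False
    define n where "n = length w"
    define B where "B = norm b"
    \<comment> \<open>Chosen so that \<open>\<rho> - r = r * (B * A)\<close>: the geometric sum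
      below, times \<open>B * A\<close>, is then exactly \<open>\<rho> ^ n - r ^ n\<close>.\<close>
    define \<rho> where "\<rho> = r * (1 + B * A)"
    \<comment> \<open>The value 0 at \<open>k = 0\<close> mirrors the omitted term
      \<open>u = []\<close>.\<close>
    define f where "f k = (if k = 0 then 0 else A * r ^ k * fact k)" for k
    define g where "g k = B * \<rho> ^ k * fact k" for k
    have pos: "0 \<le> \<rho>" "0 \<le> B"
      using nonneg by (auto simp: \<rho>_def B_def)
    have sub: "sorted u" "set u \<subseteq> I" "length u \<le> length w" if "subseq u w" for u
      using subseq_sorted_subset[OF that] 1 by auto
    let ?G = "\<lambda>u v. if u = [] then 0 else the (word_deriv \<delta> u a) * the (word_deriv \<delta> v b)"
    have "norm (split_sum ?G w) \<le> split_sum (\<lambda>u v. norm (?G u v)) w"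
      by (rule norm_split_sum_le)
    also have "\<dots> \<le> split_sum (\<lambda>u v. f (length u) * g (length v)) w"
    proof (rule split_sum_mono)
      fix u v assume *: "subseq u w" "subseq v w" "length u + length v = length w"
      show "norm (?G u v) \<le> f (length u) * g (length v)"
      proof (cases "u = []")
        case False
        then have "length v < length w"
          using *(3) by (cases u) auto
        then have "norm (the (word_deriv \<delta> v b)) \<le> g (length v)"
          using 1(1) sub[OF *(2)] 1(4) unfolding g_def \<rho>_def B_def by simp
        moreover have "norm (the (word_deriv \<delta> u a)) \<le> f (length u)"
          using False bound[of u] sub[OF *(1)] 1(4) unfolding f_def by simp
        ultimately have "norm (the (word_deriv \<delta> u a)) * norm (the (word_deriv \<delta> v b)) \<le>
            f (length u) * g (length v)"
          using nonneg by (intro mult_mono) (auto simp: f_def)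
        with False show ?thesis
          by (simp add: order_trans[OF norm_mult_ineq])
      qed (simp add: f_def)
    qed
    also have "\<dots> = (\<Sum>k\<le>n. (n choose k) * (f k * g (n - k)))"
      unfolding n_def by (rule split_sum_length)
    also have "\<dots> = (\<Sum>k=1..n. (n choose k) * (f k * g (n - k)))"
      by (rule sum.mono_neutral_right) (auto simp: f_def)
    also have "\<dots> = (\<Sum>k=1..n. A * B * fact n * (r ^ k * \<rho> ^ (n - k)))"
    proof (rule sum.cong)
      fix k assume k: "k \<in> {1..n}"
      \<comment> \<open>The factorials in the two bounds absorb the binomial coefficient.\<close>
      then have "real (n choose k) * (fact k * fact (n - k)) = fact n"
        by (simp add: binomial_fact)
      moreover have "(n choose k) * (f k * g (n - k)) =
          A * B * (real (n choose k) * (fact k * fact (n - k))) * (r ^ k * \<rho> ^ (n - k))"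
        using k by (simp add: f_def g_def)
      ultimately show "(n choose k) * (f k * g (n - k)) = A * B * fact n * (r ^ k * \<rho> ^ (n - k))"
        by metis
    qed simp
    also have "\<dots> = fact n * ((B * A) * (\<Sum>k=1..n. r ^ k * \<rho> ^ (n - k)))"
      by (simp add: sum_distrib_left mult_ac)
    also have "\<dots> = fact n * (\<rho> ^ n - r ^ n)"
      unfolding \<rho>_def geometric_sum_ratio ..
    also have "\<dots> \<le> \<rho> ^ n * fact n"
      using nonneg by (simp add: mult.commute)
    finally have S: "norm (split_sum ?G w) \<le> \<rho> ^ n * fact n" .
    have "the (word_deriv \<delta> w b) = - (b * split_sum ?G w)"
      using 1(3) by (intro word_deriv_inverse der a b sub ab False) auto
    then have "norm (the (word_deriv \<delta> w b)) \<le> B * norm (split_sum ?G w)"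
      using norm_mult_ineq[of b "split_sum ?G w"] by (simp add: B_def)
    also have "\<dots> \<le> B * (\<rho> ^ n * fact n)"
      by (intro mult_left_mono S pos)
    finally show ?thesis
      by (simp add: n_def B_def \<rho>_def mult.assoc)
  qed simp
qed

section \<open>From almost increasing roots to the Carleman class\<close>

lemma almost_increasing_root_bound:
  fixes M :: "nat \<Rightarrow> real"
  assumes "\<And>k. 0 < M k" "almost_increasing (\<lambda>k. root (Suc k) (M (Suc k) / fact (Suc k)))"
  obtains C where "1 \<le> C"
    "\<And>k K. 1 \<le> k \<Longrightarrow> k \<le> K \<Longrightarrow> M k \<le> (C * root K (M K / fact K)) ^ k * fact k"
proof -
  obtain C0 where C0: "0 < C0" "\<And>k l. k < l \<Longrightarrow>
      root (Suc k) (M (Suc k) / fact (Suc k)) \<le> C0 * root (Suc l) (M (Suc l) / fact (Suc l))"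
    using assms(2) unfolding almost_increasing_def by blast
  show thesis
  \<comment> \<open>Almost monotonicity compares distinct indices only; the maximum with 1 covers
    \<open>k = K\<close>.\<close>
  proof (rule that[of "max C0 1"])
    fix k K :: nat assume k: "1 \<le> k" "k \<le> K"
    let ?u = "\<lambda>k. root k (M k / fact k)"
    have u: "0 \<le> ?u n" for n
      using assms(1)[of n] by (cases "n = 0") auto
    have "?u k \<le> max C0 1 * ?u K"
    proof (cases "k = K")
      case False
      \<comment> \<open>The hypothesis lists the roots from order 1 on, hence the shift of both
        indices by one.\<close>
      then have "?u k \<le> C0 * ?u K"
        using C0(2)[of "k - 1" "K - 1"] k by simp
      also have "\<dots> \<le> max C0 1 * ?u K"
        by (intro mult_right_mono u) simp
      finally show ?thesis .
    next
      case True
      then show ?thesis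
        using mult_right_mono[OF _ u, of 1 "max C0 1" K] by simp
    qed
    then have "?u k ^ k \<le> (max C0 1 * ?u K) ^ k"
      by (intro power_mono u)
    moreover have "?u k ^ k = M k / fact k"
      using k assms(1)[of k] by (intro real_root_pow_pos2) auto
    ultimately show "M k \<le> (max C0 1 * ?u K) ^ k * fact k"
      by (simp add: pos_divide_le_eq)
  qed simp
qed

theorem theorem16:
  fixes d :: nat
    and \<delta> :: "nat \<Rightarrow> 'a::{real_normed_algebra, ring_1, banach} \<rightharpoonup> 'a"
    and M Mc :: "nat \<Rightarrow> real"
  assumes "\<And>j. j \<in> {1..d} \<Longrightarrow> derivation (\<delta> j)"
    and "\<And>i j. i \<in> {1..d} \<Longrightarrow> j \<in> {1..d} \<Longrightarrow> commute (\<delta> i) (\<delta> j)"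
    and "\<And>j. j \<in> {1..d} \<Longrightarrow> inverse_closed (dom (\<delta> j))"
    and "\<And>k. 0 < M k" and "M 0 = 1"
    and "log_convex_regularization M Mc"
    and "carleman_class d \<delta> M = carleman_class d \<delta> Mc"
    and "almost_increasing (\<lambda>k. root (Suc k) (M (Suc k) / fact (Suc k)))"
  shows "inverse_closed (carleman_class d \<delta> M)"
  unfolding inverse_closed_def
proof (intro ballI allI impI, elim conjE)
  fix a b :: 'a
  assume "a \<in> carleman_class d \<delta> M" and ab: "a * b = 1" "b * a = 1"
  then obtain r where r: "0 < r" "a \<in> carleman_at d \<delta> r M"
    by (auto simp: carleman_class_def)
  then obtain A where dom_a: "\<And>w. sorted w \<Longrightarrow> set w \<subseteq> {1..d} \<Longrightarrow> a \<in> dom (word_deriv \<delta> w)"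
    and A: "\<And>w. sorted w \<Longrightarrow> set w \<subseteq> {1..d} \<Longrightarrow>
       norm (the (word_deriv \<delta> w a)) \<le> A * (r ^ length w * M (length w))"
    using mem_carleman_at_iff[OF r(1), of M] assms(4) by blast
  have "norm a \<le> A"
    using A[of "[]"] assms(5) by simp
  then have A0: "0 \<le> A"
    using norm_ge_zero order_trans by blast
  obtain C where C: "1 \<le> C"
    "\<And>k K. 1 \<le> k \<Longrightarrow> k \<le> K \<Longrightarrow> M k \<le> (C * root K (M K / fact K)) ^ k * fact k"
    using almost_increasing_root_bound[of M] assms(4,8) by metis
  have dom_b: "b \<in> dom (word_deriv \<delta> w)" if "sorted w" "set w \<subseteq> {1..d}" for w
    using word_deriv_inverse_dom[where I = "{1..d}", OF assms(1,3) dom_a ab that] .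
  \<comment> \<open>The rate from \<open>word_deriv_inverse_bound\<close> without its factor
    \<open>s\<close>, so it is the same for all words.\<close>
  define R where "R = r * C * (1 + norm b * A)"
  have R: "0 < R"
    using r(1) C(1) A0 by (simp add: R_def add_pos_nonneg)
  have "norm (the (word_deriv \<delta> w b)) \<le> norm b * (R ^ length w * M (length w))"
    if w: "sorted w" "set w \<subseteq> {1..d}" for w
  proof (cases "w = []")
    case True
    then show ?thesis
      using assms(5) by simp
  next
    case False
    define K where "K = length w"
    \<comment> \<open>Chosen to satisfy \<open>s ^ K * fact K = M K\<close>. It varies with the
      length of \<open>w\<close>, so the bound for the inverse is applied afresh for each
      length.\<close>
    define s where "s = root K (M K / fact K)"
    have K: "0 < K"
      using False by (simp add: K_def)
    have M: "0 \<le> M K / fact K"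
      using assms(4)[of K] by simp
    have s: "0 \<le> r * (C * s)"
      using C(1) r(1) real_root_ge_zero[OF M] by (simp add: s_def)
    \<comment> \<open>Up to order \<open>K\<close>, the Carleman bounds on \<open>a\<close> become
      factorial bounds with the single rate \<open>r * (C * s)\<close>.\<close>
    have "norm (the (word_deriv \<delta> v a)) \<le> A * (r * (C * s)) ^ length v * fact (length v)"
      if "sorted v" "set v \<subseteq> {1..d}" "length v \<le> K" "v \<noteq> []" for v
    proof -
      have "M (length v) \<le> (C * s) ^ length v * fact (length v)"
        unfolding s_def using that by (intro C(2)) (auto simp: Suc_le_eq)
      then have "A * (r ^ length v * M (length v)) \<le>
          A * (r ^ length v * ((C * s) ^ length v * fact (length v)))"
        using A0 r(1) by (intro mult_left_mono) auto
      then show ?thesis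
        using A[OF that(1,2)] by (simp add: power_mult_distrib mult_ac)
    qed
    then have "norm (the (word_deriv \<delta> w b)) \<le>
        norm b * (r * (C * s) * (1 + norm b * A)) ^ length w * fact (length w)"
      using s by (intro word_deriv_inverse_bound[where I = "{1..d}" and K = K,
            OF assms(1) dom_a dom_b ab _ A0 _ w]) (auto simp: K_def)
    also have "\<dots> = norm b * (R ^ K * (s ^ K * fact K))"
      by (simp add: R_def K_def power_mult_distrib mult_ac)
    also have "s ^ K = M K / fact K"
      unfolding s_def by (rule real_root_pow_pos2[OF K M])
    finally show ?thesis
      by (simp add: K_def)
  qed
  then have "b \<in> carleman_at d \<delta> R M"
    using mem_carleman_at_iff[OF R, of M] assms(4) dom_b by blast
  then show "b \<in> carleman_class d \<delta> M"
    using R by (auto simp: carleman_class_def)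
qed

end
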